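(* Let $\tau$ be a non-Fibonacci permutation. For every integer $k\ge 0$ there exists a polynomial $P$ of degree $k$ and an integer $n_0$ such that for every $n\ge n_0$, $S_n^k(\tau)=P(n)$. Moreover, $P(n)=\frac{n^k}{k!}+O(n^{k-1})$ as $n\to\infty$.
   Context: A permutation $\pi=\pi_1\cdots\pi_n$ of $\{1,\dots,n\}$ contains a permutation (pattern) $\tau$ of length $\ell$ if there are indices $i_1<\cdots<i_\ell$ such that $\pi_{i_1}\cdots\pi_{i_\ell}$ is order-isomorphic to $\tau$; otherwise $\pi$ avoids $\tau$. An inversion in $\pi$ is a pair $(i,j)$ with $1\le i<j\le n$ and $\pi_i>\pi_j$. $S_n^k(\tau)$ denotes the number of permutations of length $n$ avoiding $\tau$ that have exactly $k$ inversions. The direct sum $\sigma\oplus\rho$ of permutations $\sigma$ of length $a$ and $\rho$ of length $b$ is the permutation of length $a+b$ with $(\sigma\oplus\rho)(i)=\sigma(i)$ for $i\le a$ and $(\sigma\oplus\rho)(i)=\rho(i-a)+a$ for $i>a$. A Fibonacci permutation is a permutation that can be written as a direct sum $\alpha_1\oplus\alpha_2\oplus\cdots\oplus\alpha_m$ where each $\alpha_i$ is equal to $1$ or to $21$; a permutation is non-Fibonacci if it is not a Fibonacci permutation. *)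

theory Defs
  imports
    "HOL-Combinatorics.Multiset_Permutations"
    "HOL-Computational_Algebra.Polynomial"
    "HOL-Library.Landau_Symbols"
begin

text \<open>
  A permutation of \<open>{1, \<dots>, n}\<close> is represented by its one-line word
  \<open>\<pi>\<^sub>1 \<dots> \<pi>\<^sub>n\<close>, i.e. by an element of \<^term>\<open>permutations_of_set {1..n::nat}\<close>.
  List positions start at 0, so \<open>\<pi>\<^sub>i\<close> is \<open>\<pi> ! (i - 1)\<close>; values start at 1.
\<close>

definition is_permutation :: "nat list \<Rightarrow> bool" where
  "is_permutation \<pi> \<longleftrightarrow> \<pi> \<in> permutations_of_set {1..length \<pi>}"

definition order_isomorphic :: "nat list \<Rightarrow> nat list \<Rightarrow> bool" where
  "order_isomorphic u v \<longleftrightarrow>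
     length u = length v \<and>
     (\<forall>i<length u. \<forall>j<length u. u ! i < u ! j \<longleftrightarrow> v ! i < v ! j)"

definition contains :: "nat list \<Rightarrow> nat list \<Rightarrow> bool" where
  "contains \<pi> \<tau> \<longleftrightarrow>
     (\<exists>f::nat \<Rightarrow> nat. strict_mono_on {..<length \<tau>} f \<and>
        (\<forall>j<length \<tau>. f j < length \<pi>) \<and>
        order_isomorphic (map (\<lambda>j. \<pi> ! f j) [0..<length \<tau>]) \<tau>)"

definition avoids :: "nat list \<Rightarrow> nat list \<Rightarrow> bool" where
  "avoids \<pi> \<tau> \<longleftrightarrow> \<not> contains \<pi> \<tau>"

definition inversions :: "nat list \<Rightarrow> (nat \<times> nat) set" where
  "inversions \<pi> = {(i, j). i < j \<and> j < length \<pi> \<and> \<pi> ! i > \<pi> ! j}"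

definition num_avoiders :: "nat list \<Rightarrow> nat \<Rightarrow> nat \<Rightarrow> nat" where
  "num_avoiders \<tau> n k =
     card {\<pi> \<in> permutations_of_set {1..n}. avoids \<pi> \<tau> \<and> card (inversions \<pi>) = k}"

definition direct_sum :: "nat list \<Rightarrow> nat list \<Rightarrow> nat list" where
  "direct_sum \<sigma> \<rho> = \<sigma> @ map (\<lambda>x. x + length \<sigma>) \<rho>"

text \<open>
  The list of summands may be empty, so the empty permutation is a Fibonacci permutation.
\<close>

definition fibonacci_permutation :: "nat list \<Rightarrow> bool" where
  "fibonacci_permutation \<pi> \<longleftrightarrow>
     (\<exists>\<alpha>s. set \<alpha>s \<subseteq> {[1], [2, 1]} \<and> \<pi> = foldr direct_sum \<alpha>s [])"

end

theory Submission
  imports Defs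
begin

text \<open>
  A permutation is determined by its inversion code: the word whose entry at each position is the
  number of later, smaller entries. The sum of the code is the number of inversions, and
  concatenation of codes is direct sum of permutations. A code with sum \<open>k\<close> has at most \<open>k\<close> nonzero
  letters, so for large \<open>n\<close> it is a sparse word, and all but boundedly many of its zeros lie in
  long runs. After any prefix, \<open>k\<close> zeros suffice to close off the inversions started in it; further
  zeros are a block of fixed points that is a direct summand. An occurrence of \<open>\<tau>\<close> uses at most
  \<open>length \<tau>\<close> points of such a block, so once the block is that long, making it
  longer does not change whether \<open>\<tau>\<close> is avoided (\<open>run_stable_avoiding_codes\<close>).

  It remains to count the words of length \<open>n\<close> and sum \<open>k\<close> with any property that ignores the excess
  length of long zero runs (\<open>word_count_eventually_poly\<close>). Fix the number \<open>g\<close> of zeros in front and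
  ask what comes next: another zero, or a letter \<open>a \<ge> 1\<close>, which leaves the same problem for the
  smaller sum \<open>k - a\<close>. If \<open>g\<close> is large, another zero changes nothing, so the counting function has
  an eventually polynomial difference and is therefore eventually polynomial itself, of degree one
  more; smaller \<open>g\<close> follow by descending recursion. Only the letter \<open>a = 1\<close> contributes to the top
  degree, so the coefficient of \<open>n\<^sup>k\<close> is decided by the codes in which every nonzero letter is a
  \<open>1\<close> followed by a \<open>0\<close>. These are the codes of Fibonacci permutations, and if all of them have the
  property, then the recursion gives the coefficient \<open>1/k!\<close>.

  Fibonacci permutations are those whose inversions all occupy adjacent positions. This
  property is inherited by patterns, so they all avoid the non-Fibonacci \<open>\<tau>\<close>
  (\<open>fib_code_avoids\<close>) and the leading coefficient is indeed \<open>1/k!\<close>.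
\<close>

section \<open>Eventually polynomial sequences\<close>

text \<open>
  The number \<open>a\<close> is the coefficient at \<open>d\<close>, not the leading coefficient: it may be zero. With this
  convention the coefficients at a common \<open>d\<close> add up under sums, and contributions of lower degree are those
  with \<open>a = 0\<close>.
\<close>

definition eventually_poly :: "nat \<Rightarrow> real \<Rightarrow> (nat \<Rightarrow> real) \<Rightarrow> bool" where
  "eventually_poly d a f \<longleftrightarrow>
     (\<exists>p. degree p \<le> d \<and> coeff p d = a \<and> (\<forall>\<^sub>F n in sequentially. f n = poly p (real n)))"

lemma eventually_poly_add:
  assumes "eventually_poly d a f" "eventually_poly d b g"
  shows "eventually_poly d (a + b) (\<lambda>n. f n + g n)"
proof -
  obtain p where p: "degree p \<le> d" "coeff p d = a" "\<forall>\<^sub>F n in sequentially. f n = poly p (real n)"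
    using assms(1) unfolding eventually_poly_def by blast
  obtain q where q: "degree q \<le> d" "coeff q d = b" "\<forall>\<^sub>F n in sequentially. g n = poly q (real n)"
    using assms(2) unfolding eventually_poly_def by blast
  have "\<forall>\<^sub>F n in sequentially. f n + g n = poly (p + q) (real n)"
    using p(3) q(3) by eventually_elim simp
  moreover have "degree (p + q) \<le> d" "coeff (p + q) d = a + b"
    using p q by (simp_all add: degree_add_le)
  ultimately show ?thesis
    unfolding eventually_poly_def by blast
qed

lemma eventually_poly_const: "eventually_poly 0 a (\<lambda>_. a)"
  unfolding eventually_poly_def by (rule exI[of _ "[:a:]"]) simp

lemma eventually_poly_zero: "eventually_poly d 0 (\<lambda>_. 0)"
  unfolding eventually_poly_def by (rule exI[of _ 0]) simp

lemma eventually_poly_sum: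
  assumes "finite A" "\<And>i. i \<in> A \<Longrightarrow> eventually_poly d (a i) (f i)"
  shows "eventually_poly d (\<Sum>i\<in>A. a i) (\<lambda>n. \<Sum>i\<in>A. f i n)"
  using assms
  by (induction A rule: finite_induct) (simp_all add: eventually_poly_zero eventually_poly_add)

lemma eventually_poly_mono:
  assumes "eventually_poly d a f" "d < e"
  shows "eventually_poly e 0 f"
proof -
  obtain p where p: "degree p \<le> d" "\<forall>\<^sub>F n in sequentially. f n = poly p (real n)"
    using assms(1) unfolding eventually_poly_def by blast
  moreover have "degree p \<le> e" "coeff p e = 0"
    using p(1) assms(2) by (auto intro: coeff_eq_0)
  ultimately show ?thesis
    unfolding eventually_poly_def by blast
qed

lemma eventually_poly_cong:
  assumes "eventually_poly d a f" "\<forall>\<^sub>F n in sequentially. g n = f n"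
  shows "eventually_poly d a g"
proof -
  obtain p where p: "degree p \<le> d" "coeff p d = a" "\<forall>\<^sub>F n in sequentially. f n = poly p (real n)"
    using assms(1) unfolding eventually_poly_def by blast
  have "\<forall>\<^sub>F n in sequentially. g n = poly p (real n)"
    using assms(2) p(3) by eventually_elim simp
  with p show ?thesis
    unfolding eventually_poly_def by blast
qed

lemma coeff_pcompose_shift:
  fixes p :: "real poly"
  assumes "degree p \<le> d"
  shows "coeff (pcompose p [:c, 1:]) d = coeff p d"
proof (cases "degree p = d")
  case True
  then show ?thesis
    using lead_coeff_comp[of "[:c, 1:]" p] by (simp add: degree_pcompose)
next
  case False
  then show ?thesis
    using assms by (simp add: coeff_eq_0 degree_pcompose)
qed

lemma eventually_poly_shift:
  assumes "eventually_poly d a g" "\<And>n. f (Suc n) = g n"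
  shows "eventually_poly d a f"
proof -
  obtain p where p: "degree p \<le> d" "coeff p d = a" "\<forall>\<^sub>F n in sequentially. g n = poly p (real n)"
    using assms(1) unfolding eventually_poly_def by blast
  let ?q = "pcompose p [:-1, 1:]"
  have "\<forall>\<^sub>F n in sequentially. f (Suc n) = poly ?q (real (Suc n))"
    using p(3) by eventually_elim (simp add: poly_pcompose assms(2))
  then have "\<forall>\<^sub>F n in sequentially. f n = poly ?q (real n)"
    by (rule eventually_sequentially_Suc[THEN iffD1])
  moreover have "degree ?q \<le> d" "coeff ?q d = a"
    using p by (simp_all add: coeff_pcompose_shift degree_pcompose)
  ultimately show ?thesis
    unfolding eventually_poly_def by blast
qed

text \<open>
  If \<open>c\<close> is the coefficient of \<open>p\<close> at \<open>X\<^sup>d\<close>, the monomial \<open>c X\<^bsup>d+1\<^esup> / (d+1)\<close> has a difference of degree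
  at most \<open>d\<close> with the same coefficient \<open>c\<close>. What remains of \<open>p\<close> has smaller degree, so the
  antidifference is built by recursion on the degree.
\<close>

lemma poly_antidifference:
  fixes p :: "real poly"
  assumes "degree p \<le> d"
  shows "\<exists>q. degree q \<le> Suc d \<and> coeff q (Suc d) = coeff p d / real (Suc d) \<and>
             pcompose q [:1, 1:] - q = p"
  using assms
proof (induction d arbitrary: p)
  case 0
  then obtain c where c: "p = [:c:]"
    by (auto elim: degree_eq_zeroE)
  show ?case
    by (rule exI[of _ "[:0, c:]"]) (simp add: c pcompose_pCons)
next
  case (Suc d)
  define c where "c = coeff p (Suc d) / real (Suc (Suc d))"
  define m where "m = monom c (Suc (Suc d))"
  define \<Delta> where "\<Delta> = pcompose m [:1, 1:] - m"
  have comp: "pcompose m [:1, 1:] = smult c ([:1, 1:] ^ Suc (Suc d))"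
    unfolding m_def poly_eq_poly_eq_iff[symmetric]
    by (simp add: fun_eq_iff poly_pcompose poly_monom del: power_Suc)
  have coeff_comp: "coeff (pcompose m [:1, 1:]) i = c * real (Suc (Suc d) choose i)"
    if "i \<le> Suc (Suc d)" for i
    using that by (simp add: comp coeff_linear_poly_power del: power_Suc binomial_Suc_Suc)
  have deg_m: "degree m \<le> Suc (Suc d)"
    unfolding m_def by (rule degree_monom_le)
  then have "degree (pcompose m [:1, 1:]) \<le> Suc (Suc d)"
    by (simp add: degree_pcompose)
  with deg_m have "degree \<Delta> \<le> Suc (Suc d)"
    unfolding \<Delta>_def by (intro degree_diff_le)
  moreover have "coeff \<Delta> (Suc (Suc d)) = 0"
    unfolding \<Delta>_def by (simp add: coeff_comp) (simp add: m_def)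
  ultimately have "degree \<Delta> \<le> Suc d"
    by (metis coeff_0 degree_0 le_SucE leading_coeff_0_iff le0)
  then have "degree (p - \<Delta>) \<le> Suc d"
    using Suc.prems by (simp add: degree_diff_le)
  moreover have "coeff (p - \<Delta>) (Suc d) = 0"
  proof -
    have "Suc (Suc d) choose Suc d = Suc (Suc d)"
      using binomial_symmetric[of 1 "Suc (Suc d)"] by simp
    then have "coeff \<Delta> (Suc d) = coeff p (Suc d)"
      by (simp add: \<Delta>_def coeff_comp) (simp add: m_def c_def)
    then show ?thesis by simp
  qed
  ultimately have "degree (p - \<Delta>) \<le> d"
    by (metis coeff_0 degree_0 le_SucE leading_coeff_0_iff le0)
  from Suc.IH[OF this] obtain q where
    q: "degree q \<le> Suc d" "pcompose q [:1, 1:] - q = p - \<Delta>"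
    by blast
  have "degree (q + m) \<le> Suc (Suc d)"
    using q(1) deg_m by (intro degree_add_le) auto
  moreover have "coeff (q + m) (Suc (Suc d)) = c"
    using q(1) by (simp add: m_def coeff_eq_0)
  moreover have "pcompose (q + m) [:1, 1:] - (q + m) = p"
    using q(2) by (simp add: \<Delta>_def pcompose_add algebra_simps)
  ultimately show ?case
    unfolding c_def by blast
qed

lemma eventually_poly_antidifference:
  assumes "eventually_poly d a h" "\<And>n. f (Suc n) = f n + h n"
  shows "eventually_poly (Suc d) (a / real (Suc d)) f"
proof -
  obtain p where p: "degree p \<le> d" "coeff p d = a" "\<forall>\<^sub>F n in sequentially. h n = poly p (real n)"
    using assms(1) unfolding eventually_poly_def by blast
  obtain q where q: "degree q \<le> Suc d" "coeff q (Suc d) = a / real (Suc d)"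
      "pcompose q [:1, 1:] - q = p"
    using poly_antidifference[OF p(1)] p(2) by blast
  obtain N where N: "\<And>n. n \<ge> N \<Longrightarrow> h n = poly p (real n)"
    using p(3) unfolding eventually_sequentially by blast
  define r where "r = q + [:f N - poly q (real N):]"
  have q_step: "poly q (1 + real n) = poly q (real n) + poly p (real n)" for n
    unfolding q(3)[symmetric] by (simp add: poly_pcompose)
  have "f n = poly r (real n)" if "n \<ge> N" for n
    using that
  proof (induction n rule: dec_induct)
    case base
    then show ?case by (simp add: r_def)
  next
    case (step n)
    then show ?case
      using assms(2)[of n] N[of n] q_step[of n] by (simp add: r_def)
  qed
  then have "\<forall>\<^sub>F n in sequentially. f n = poly r (real n)"
    unfolding eventually_sequentially by blast
  moreover have "degree r \<le> Suc d"
    unfolding r_def using q(1) by (intro degree_add_le) auto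
  moreover have "coeff r (Suc d) = a / real (Suc d)"
    unfolding r_def using q(2) by simp
  ultimately show ?thesis
    unfolding eventually_poly_def by blast
qed

section \<open>Counting words with long runs of zeros\<close>

definition word_count :: "(nat list \<Rightarrow> bool) \<Rightarrow> nat \<Rightarrow> nat \<Rightarrow> nat" where
  "word_count P n k = card {c. length c = n \<and> sum_list c = k \<and> P c}"

lemma finite_words: "finite {c :: nat list. length c = n \<and> sum_list c = k \<and> P c}"
proof (rule finite_subset)
  show "{c. length c = n \<and> sum_list c = k \<and> P c} \<subseteq> {c. set c \<subseteq> {..k} \<and> length c = n}"
    by (auto intro: member_le_sum_list)
qed (rule finite_lists_length_eq, simp)

lemma word_count_Suc:
  "word_count P (Suc n) k = (\<Sum>a\<le>k. word_count (\<lambda>c. P (a # c)) n (k - a))"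
proof -
  let ?S = "\<lambda>a. {c. length c = n \<and> sum_list c = k - a \<and> P (a # c)}"
  have "{c. length c = Suc n \<and> sum_list c = k \<and> P c} = (\<Union>a\<le>k. (#) a ` ?S a)"
    by (auto simp: length_Suc_conv image_iff)
  then have "word_count P (Suc n) k = card (\<Union>a\<le>k. (#) a ` ?S a)"
    by (simp add: word_count_def)
  also have "\<dots> = (\<Sum>a\<le>k. card ((#) a ` ?S a))"
    by (rule card_UN_disjoint) (auto simp: finite_words)
  also have "\<dots> = (\<Sum>a\<le>k. word_count (\<lambda>c. P (a # c)) n (k - a))"
    by (intro sum.cong refl) (simp add: word_count_def card_image)
  finally show ?thesis .
qed

lemma word_count_cong:
  assumes "\<And>c. sum_list c = k \<Longrightarrow> P c \<longleftrightarrow> Q c"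
  shows "word_count P n k = word_count Q n k"
proof -
  have "{c. length c = n \<and> sum_list c = k \<and> P c} = {c. length c = n \<and> sum_list c = k \<and> Q c}"
    using assms by blast
  then show ?thesis by (simp add: word_count_def)
qed

lemma word_count_0: "word_count P n 0 = (if P (replicate n 0) then 1 else 0)"
proof -
  have eq: "length c = n \<and> sum_list c = 0 \<longleftrightarrow> c = replicate n 0" for c :: "nat list"
    by (auto intro: replicate_eqI simp: sum_list_replicate)
  have "{c. length c = n \<and> sum_list c = 0 \<and> P c} = {c. c = replicate n 0 \<and> P c}"
    by (simp only: eq flip: conj_assoc)
  also have "\<dots> = (if P (replicate n 0) then {replicate n 0} else {})"
    by auto
  finally show ?thesis
    by (simp add: word_count_def)
qed

text \<open>
  Only words with the sum under consideration are compared. For codes the threshold \<open>L\<close> has to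
  grow with the sum, since a letter \<open>a\<close> needs \<open>a\<close> further letters after it.
\<close>

definition run_stable :: "nat \<Rightarrow> nat \<Rightarrow> (nat list \<Rightarrow> bool) \<Rightarrow> bool" where
  "run_stable L k P \<longleftrightarrow>
     (\<forall>u v. sum_list u + sum_list v = k \<longrightarrow>
        P (u @ replicate (Suc L) 0 @ v) = P (u @ replicate L 0 @ v))"

lemma run_stable_prefix:
  assumes "run_stable L k P" "sum_list w \<le> k"
  shows "run_stable L (k - sum_list w) (\<lambda>c. P (w @ c))"
  unfolding run_stable_def
proof (intro allI impI)
  fix u v :: "nat list"
  assume "sum_list u + sum_list v = k - sum_list w"
  then have "sum_list (w @ u) + sum_list v = k"
    using assms(2) by simp
  then show "P (w @ u @ replicate (Suc L) 0 @ v) = P (w @ u @ replicate L 0 @ v)"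
    using assms(1) unfolding run_stable_def by (metis append_assoc)
qed

text \<open>
  These are the words that become Fibonacci permutations: a zero stands for the summand \<open>1\<close> and
  the pair \<open>1, 0\<close> for the summand \<open>21\<close>.
\<close>

inductive fib_code :: "nat list \<Rightarrow> bool" where
  Nil: "fib_code []"
| zero: "fib_code c \<Longrightarrow> fib_code (0 # c)"
| one_zero: "fib_code c \<Longrightarrow> fib_code (1 # 0 # c)"

lemma fib_code_zeros: "fib_code c \<Longrightarrow> fib_code (replicate g 0 @ c)"
  by (induction g) (auto intro: fib_code.intros)

lemma fib_code_zeroD: "fib_code (0 # c) \<Longrightarrow> fib_code c"
  by (auto elim: fib_code.cases)

text \<open>
  The induction on the sum \<open>k\<close> strips a prefix \<open>0\<^sup>g a\<close> with \<open>a \<ge> 1\<close> from the word. The condition for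
  the coefficient concerns only words that begin with a zero, because these are the ones that
  stay a \<open>fib_code\<close> when the letter \<open>1\<close> is put in front of them.
\<close>

lemma word_count_eventually_poly:
  assumes "L > 0" "run_stable L k P"
  shows "\<exists>a. eventually_poly k a (\<lambda>n. real (word_count P n k)) \<and>
             ((\<forall>c. fib_code (0 # c) \<and> sum_list c = k \<longrightarrow> P (0 # c)) \<longrightarrow> a = 1 / fact k)"
  using assms(2)
proof (induction k arbitrary: P rule: less_induct)
  case (less k)
  show ?case
  proof (cases k)
    case 0
    define a :: real where "a = (if P (replicate L 0) then 1 else 0)"
    have stable: "P (replicate n 0) = P (replicate L 0)" if "n \<ge> L" for n
      using that
    proof (induction n rule: dec_induct)
      case (step n)
      have "P ([] @ replicate (Suc L) 0 @ replicate (n - L) 0) =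
            P ([] @ replicate L 0 @ replicate (n - L) 0)"
        using less.prems unfolding run_stable_def 0 by (metis add_0 sum_list.Nil sum_list_replicate mult_0_right)
      then show ?case
        using step by (simp flip: replicate_add replicate_Suc)
    qed simp
    have "real (word_count P n k) = a" if "n \<ge> L" for n
      by (simp add: 0 word_count_0 a_def stable[OF that])
    then have "\<forall>\<^sub>F n in sequentially. real (word_count P n k) = a"
      unfolding eventually_sequentially by blast
    then have "eventually_poly k a (\<lambda>n. real (word_count P n k))"
      unfolding 0 by (rule eventually_poly_cong[OF eventually_poly_const])
    moreover have "a = 1 / fact k" if "\<forall>c. fib_code (0 # c) \<and> sum_list c = k \<longrightarrow> P (0 # c)"
    proof -
      have "fib_code (0 # replicate (L - 1) 0)"
        using fib_code_zeros[OF fib_code.Nil] by (auto intro: fib_code.zero)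
      then have "P (0 # replicate (L - 1) 0)"
        using that 0 by (simp add: sum_list_replicate)
      moreover have "replicate L 0 = (0::nat) # replicate (L - 1) 0"
        using \<open>L > 0\<close> by (cases L) simp_all
      ultimately show ?thesis
        using 0 by (simp add: a_def)
    qed
    ultimately show ?thesis by blast
  next
    case (Suc m)
    \<comment> \<open>\<open>f g\<close> counts the words that may follow \<open>g\<close> zeros; \<open>h g\<close> counts those of them, one letter
        longer, whose first letter is nonzero.\<close>
    define f where "f g n = real (word_count (\<lambda>c. P (replicate g 0 @ c)) n k)" for g n
    define h where "h g n = (\<Sum>a\<in>{1..k}. real (word_count (\<lambda>c. P (replicate g 0 @ a # c)) n (k - a)))" for g n
    have f_Suc: "f g (Suc n) = f (Suc g) n + h g n" for g n
    proof -
      have "{..k} = insert 0 {1..k}" by auto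
      then show ?thesis
        by (simp add: f_def h_def word_count_Suc replicate_app_Cons_same)
    qed
    have f_L: "f (Suc L) n = f L n" for n
    proof -
      have "P (replicate (Suc L) 0 @ c) = P (replicate L 0 @ c)" if "sum_list c = k" for c
        using less.prems that unfolding run_stable_def by (metis add_0 append_Nil sum_list.Nil)
      then have "word_count (\<lambda>c. P (replicate (Suc L) 0 @ c)) n k =
                 word_count (\<lambda>c. P (replicate L 0 @ c)) n k"
        by (rule word_count_cong)
      then show ?thesis by (simp only: f_def)
    qed
    have IH: "\<exists>b. eventually_poly (k - a) b (\<lambda>n. real (word_count (\<lambda>c. P (replicate g 0 @ a # c)) n (k - a))) \<and>
        ((\<forall>c. fib_code (0 # c) \<and> sum_list c = k - a \<longrightarrow> P (replicate g 0 @ a # 0 # c)) \<longrightarrow> b = 1 / fact (k - a))"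
      if "a \<in> {1..k}" for g a
    proof -
      have "run_stable L (k - a) (\<lambda>c. P (replicate g 0 @ a # c))"
        using run_stable_prefix[OF less.prems, of "replicate g 0 @ [a]"] that
        by (simp add: sum_list_replicate)
      with less.IH[of "k - a"] that show ?thesis by auto
    qed
    \<comment> \<open>A first letter \<open>a \<ge> 2\<close> leaves a sum below \<open>m\<close>, so only \<open>a = 1\<close> reaches degree \<open>m\<close>.\<close>
    have h: "\<exists>b. eventually_poly m b (h g) \<and>
        ((\<forall>c. fib_code (0 # c) \<and> sum_list c = m \<longrightarrow> P (replicate g 0 @ 1 # 0 # c)) \<longrightarrow> b = 1 / fact m)" for g
    proof -
      let ?w = "\<lambda>a n. real (word_count (\<lambda>c. P (replicate g 0 @ a # c)) n (k - a))"
      obtain b where b: "eventually_poly m b (?w 1)"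
        "(\<forall>c. fib_code (0 # c) \<and> sum_list c = m \<longrightarrow> P (replicate g 0 @ 1 # 0 # c)) \<longrightarrow> b = 1 / fact m"
        using IH[of 1 g] Suc by auto
      have "eventually_poly m (if a = 1 then b else 0) (?w a)" if a: "a \<in> {1..k}" for a
      proof (cases "a = 1")
        case False
        then have "k - a < m" using a Suc by auto
        then show ?thesis
          using IH[OF a, of g] False by (auto intro: eventually_poly_mono)
      qed (use b in simp)
      then have "eventually_poly m (\<Sum>a\<in>{1..k}. if a = 1 then b else 0) (h g)"
        unfolding h_def by (intro eventually_poly_sum) auto
      moreover have "(\<Sum>a\<in>{1..k}. if a = 1 then b else 0) = b"
        using Suc by simp
      ultimately show ?thesis using b(2) by auto
    qed
    obtain b where b: "eventually_poly m b (h L)"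
      "(\<forall>c. fib_code (0 # c) \<and> sum_list c = m \<longrightarrow> P (replicate L 0 @ 1 # 0 # c)) \<longrightarrow> b = 1 / fact m"
      using h by blast
    define a where "a = b / real k"
    have "eventually_poly k a (f L)"
      unfolding a_def Suc
      by (rule eventually_poly_antidifference[OF b(1)]) (simp add: f_Suc f_L)
    have "eventually_poly k a (f g)" if "g \<le> L" for g
      using that
    proof (induction g rule: inc_induct)
      case base
      show ?case by (rule \<open>eventually_poly k a (f L)\<close>)
    next
      case (step g)
      obtain b' where "eventually_poly m b' (h g)"
        using h by blast
      then have "eventually_poly k 0 (h g)"
        by (rule eventually_poly_mono) (simp add: Suc)
      with step.IH have "eventually_poly k (a + 0) (\<lambda>n. f (Suc g) n + h g n)"
        by (rule eventually_poly_add)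
      then show ?case
        by (intro eventually_poly_shift[where f = "f g"]) (simp_all add: f_Suc)
    qed
    from this[of 0] have "eventually_poly k a (\<lambda>n. real (word_count P n k))"
      by (simp add: f_def[abs_def])
    moreover have "a = 1 / fact k" if H: "\<forall>c. fib_code (0 # c) \<and> sum_list c = k \<longrightarrow> P (0 # c)"
    proof -
      have "P (replicate L 0 @ 1 # 0 # c)" if c: "fib_code (0 # c)" "sum_list c = m" for c
      proof -
        let ?w = "replicate (L - 1) 0 @ 1 # 0 # c"
        have "fib_code (1 # 0 # c)"
          using fib_code_zeroD[OF c(1)] by (rule fib_code.one_zero)
        then have "fib_code (0 # ?w)"
          by (intro fib_code.zero fib_code_zeros)
        moreover have "sum_list ?w = k"
          using c(2) Suc by (simp add: sum_list_replicate)
        ultimately have "P (0 # ?w)" using H by blast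
        moreover have "replicate L 0 = (0::nat) # replicate (L - 1) 0"
          using \<open>L > 0\<close> by (cases L) simp_all
        ultimately show ?thesis by simp
      qed
      then have "b = 1 / fact m" using b(2) by blast
      then show ?thesis
        by (simp add: a_def Suc)
    qed
    ultimately show ?thesis by blast
  qed
qed

section \<open>Permutations as inversion codes\<close>

text \<open>
  Makes room for a new entry of value \<open>Suc a\<close>: the unique increasing map from the positive integers
  onto those different from \<open>Suc a\<close>.
\<close>

definition lift :: "nat \<Rightarrow> nat \<Rightarrow> nat" where
  "lift a y = (if y \<le> a then y else Suc y)"

text \<open>
  The inverse of the Lehmer code. The head \<open>a\<close> says how many of the later entries are smaller than
  the first entry, which is therefore \<open>Suc a\<close>; the tail encodes the relative order of the rest.
\<close>

fun decode :: "nat list \<Rightarrow> nat list" where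
  "decode [] = []"
| "decode (a # c) = Suc a # map (lift a) (decode c)"

fun is_code :: "nat list \<Rightarrow> bool" where
  "is_code [] \<longleftrightarrow> True"
| "is_code (a # c) \<longleftrightarrow> a \<le> length c \<and> is_code c"

lemma strict_mono_lift: "strict_mono (lift a)"
  by (rule strict_monoI) (simp add: lift_def)

lemma inj_lift: "inj (lift a)"
  by (rule strict_mono_imp_inj_on[OF strict_mono_lift])

lemma lift_image:
  assumes "a \<le> n"
  shows "lift a ` {1..n} = {1..Suc n} - {Suc a}"
proof (intro equalityI subsetI)
  fix y assume "y \<in> {1..Suc n} - {Suc a}"
  then have "y = lift a (if y \<le> a then y else y - 1)" "(if y \<le> a then y else y - 1) \<in> {1..n}"
    using assms by (auto simp: lift_def)
  then show "y \<in> lift a ` {1..n}" by (rule image_eqI)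
qed (use assms in \<open>auto simp: lift_def\<close>)

lemma length_decode [simp]: "length (decode c) = length c"
  by (induction c) simp_all

lemma decode_pos: "x \<in> set (decode c) \<Longrightarrow> 0 < x"
  by (induction c arbitrary: x) (auto simp: lift_def)

lemma decode_permutation:
  "is_code c \<Longrightarrow> decode c \<in> permutations_of_set {1..length c}"
proof (induction c)
  case (Cons a c)
  then have IH: "set (decode c) = {1..length c}" "distinct (decode c)"
    by (auto dest: permutations_of_setD)
  have "set (map (lift a) (decode c)) = {1..Suc (length c)} - {Suc a}"
    using Cons.prems IH(1) by (simp only: set_map is_code.simps lift_image)
  moreover have "distinct (map (lift a) (decode c))"
    using IH(2) by (simp add: distinct_map inj_on_subset[OF inj_lift])
  ultimately show ?case
    using Cons.prems by (intro permutations_of_setI) auto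
qed simp

lemma inj_decode: "inj decode"
proof (rule injI)
  show "c = c'" if "decode c = decode c'" for c c'
    using that
  proof (induction c arbitrary: c')
    case Nil
    then show ?case by (cases c') simp_all
  next
    case (Cons a c)
    then obtain a' d where c': "c' = a' # d" by (cases c') simp_all
    with Cons.prems have a': "a' = a" by simp
    with c' Cons.prems have "map (lift a) (decode c) = map (lift a) (decode d)"
      by simp
    then show ?case
      using Cons.IH by (simp add: c' a' inj_map_eq_map[OF inj_lift])
  qed
qed

lemma decode_surj:
  "\<pi> \<in> permutations_of_set {1..n} \<Longrightarrow> \<exists>c. length c = n \<and> is_code c \<and> decode c = \<pi>"
proof (induction n arbitrary: \<pi>)
  case 0
  then show ?case by simp
next
  case (Suc n)
  then have \<pi>: "set \<pi> = {1..Suc n}" "distinct \<pi>"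
    by (auto dest: permutations_of_setD)
  then obtain x \<rho> where x\<rho>: "\<pi> = x # \<rho>" by (cases \<pi>) auto
  define a where "a = x - 1"
  have "x \<in> {1..Suc n}" using \<pi>(1) x\<rho> by auto
  then have x: "x = Suc a" and a: "a \<le> n" by (auto simp: a_def)
  have \<rho>: "set \<rho> = lift a ` {1..n}" "distinct \<rho>"
    unfolding lift_image[OF a] using \<pi> x\<rho> x by auto
  then have "\<rho> \<in> map (lift a) ` lists {1..n}"
    by (auto simp flip: lists_image)
  then obtain \<sigma> where \<sigma>: "\<rho> = map (lift a) \<sigma>" by blast
  have "set \<sigma> = {1..n}"
    using \<rho>(1) inj_image_eq_iff[OF inj_lift] by (simp add: \<sigma>)
  moreover have "distinct \<sigma>"
    using \<rho>(2) by (simp add: \<sigma> distinct_map)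
  ultimately obtain c where "length c = n" "is_code c" "decode c = \<sigma>"
    using Suc.IH permutations_of_setI by blast
  then have "length (a # c) = Suc n \<and> is_code (a # c) \<and> decode (a # c) = \<pi>"
    using a by (simp add: x\<rho> x \<sigma>)
  then show ?case by blast
qed

lemma inversions_Cons:
  "inversions (x # \<rho>) =
     (\<lambda>j. (0, Suc j)) ` {j. j < length \<rho> \<and> \<rho> ! j < x} \<union> map_prod Suc Suc ` inversions \<rho>"
  (is "?l = ?r")
proof (intro equalityI subsetI)
  fix p assume "p \<in> ?l"
  then obtain i j where p: "p = (i, j)" "i < j" "j < Suc (length \<rho>)" "(x # \<rho>) ! j < (x # \<rho>) ! i"
    by (auto simp: inversions_def)
  then obtain j' where "j = Suc j'" by (cases j) auto
  with p show "p \<in> ?r"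
    by (cases i) (auto simp: inversions_def image_iff)
qed (auto simp: inversions_def)

lemma inversions_map:
  assumes "strict_mono f"
  shows "inversions (map f \<rho>) = inversions \<rho>"
  by (auto simp: inversions_def strict_mono_less[OF assms])

lemma inversions_decode_Cons:
  "inversions (decode (a # c)) =
     (\<lambda>j. (0, Suc j)) ` {j. j < length c \<and> decode c ! j \<le> a} \<union>
     map_prod Suc Suc ` inversions (decode c)"
proof -
  have "{j. j < length c \<and> map (lift a) (decode c) ! j < Suc a} =
        {j. j < length c \<and> decode c ! j \<le> a}"
    by (auto simp: lift_def split: if_splits)
  then show ?thesis
    by (simp add: inversions_Cons inversions_map[OF strict_mono_lift])
qed

text \<open>
  The values of \<open>decode c\<close> are \<open>1, \<dots>, length c\<close>, so exactly \<open>a\<close> of them are at most \<open>a\<close>. These are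
  the positions that form an inversion with an entry prepended by the code letter \<open>a\<close>.
\<close>

lemma card_small_positions:
  assumes "is_code c" "a \<le> length c"
  shows "card {j. j < length c \<and> decode c ! j \<le> a} = a"
proof -
  have c: "set (decode c) = {1..length c}" "distinct (decode c)"
    using decode_permutation[OF assms(1)] by (auto dest: permutations_of_setD)
  have "card {j. j < length c \<and> decode c ! j \<le> a} = length (filter (\<lambda>y. y \<le> a) (decode c))"
    by (simp add: length_filter_conv_card)
  also have "\<dots> = card (set (filter (\<lambda>y. y \<le> a) (decode c)))"
    using c(2) by (simp add: distinct_card del: set_filter)
  also have "set (filter (\<lambda>y. y \<le> a) (decode c)) = {1..a}"
    using c(1) assms(2) by auto
  finally show ?thesis by simp
qed

lemma finite_inversions: "finite (inversions \<pi>)"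
  by (rule finite_subset[of _ "{..<length \<pi>} \<times> {..<length \<pi>}"]) (auto simp: inversions_def)

lemma card_inversions_decode: "is_code c \<Longrightarrow> card (inversions (decode c)) = sum_list c"
proof (induction c)
  case Nil
  then show ?case by (simp add: inversions_def)
next
  case (Cons a c)
  let ?J = "{j. j < length c \<and> decode c ! j \<le> a}"
  have "card (inversions (decode (a # c))) =
      card ((\<lambda>j. (0::nat, Suc j)) ` ?J) + card (map_prod Suc Suc ` inversions (decode c))"
    unfolding inversions_decode_Cons
    by (rule card_Un_disjoint) (auto simp: finite_inversions)
  also have "card ((\<lambda>j. (0::nat, Suc j)) ` ?J) = a"
    using Cons.prems by (simp add: card_image inj_on_def card_small_positions)
  also have "card (map_prod Suc Suc ` inversions (decode c)) = sum_list c"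
    using Cons by (simp add: card_image prod.inj_map inj_on_subset[of _ UNIV])
  finally show ?case by simp
qed

lemma num_avoiders_word_count:
  "num_avoiders \<tau> n k = word_count (\<lambda>c. is_code c \<and> avoids (decode c) \<tau>) n k"
proof -
  let ?C = "{c. length c = n \<and> sum_list c = k \<and> is_code c \<and> avoids (decode c) \<tau>}"
  have "{\<pi> \<in> permutations_of_set {1..n}. avoids \<pi> \<tau> \<and> card (inversions \<pi>) = k} = decode ` ?C"
    (is "?A = _")
  proof (intro equalityI subsetI)
    fix \<pi> assume \<pi>: "\<pi> \<in> ?A"
    then obtain c where "length c = n" "is_code c" "decode c = \<pi>"
      using decode_surj by blast
    with \<pi> show "\<pi> \<in> decode ` ?C"
      by (auto simp: card_inversions_decode)
  qed (use decode_permutation in \<open>auto simp: card_inversions_decode\<close>)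
  then show ?thesis
    by (simp add: num_avoiders_def word_count_def card_image inj_on_subset[OF inj_decode])
qed

section \<open>Long runs of fixed points\<close>

text \<open>
  If \<open>u\<close> is a code by itself, each of its letters counts only smaller entries that already lie
  in \<open>u\<close>, so no inversion crosses from \<open>u\<close> to \<open>v\<close>.
\<close>

lemma decode_append:
  "is_code u \<Longrightarrow> decode (u @ v) = direct_sum (decode u) (decode v)"
proof (induction u)
  case Nil
  then show ?case by (simp add: direct_sum_def)
next
  case (Cons a u)
  have "lift a (x + length u) = Suc (x + length u)" if "x \<in> set (decode v)" for x
    using decode_pos[OF that] Cons.prems by (simp add: lift_def)
  with Cons show ?case
    by (simp add: direct_sum_def)
qed

lemma decode_zeros: "decode (replicate m 0) = [1..<Suc m]"
proof (induction m)
  case (Suc m)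
  have "map (lift 0) [1..<Suc m] = map Suc [1..<Suc m]"
    by (simp add: lift_def)
  also have "\<dots> = [2..<Suc (Suc m)]"
    by (simp add: map_Suc_upt numeral_2_eq_2 del: upt_Suc)
  finally show ?case
    using Suc.IH by (simp add: upt_conv_Cons numeral_2_eq_2 del: upt_Suc)
qed simp

text \<open>
  A letter of \<open>u\<close> is at most the sum of \<open>u\<close>, so enough letters after \<open>u\<close> make every letter of \<open>u\<close>
  admissible. This is why \<open>k\<close> zeros after a prefix of sum at most \<open>k\<close> complete it to a code.
\<close>

lemma is_code_append:
  "sum_list u \<le> length w \<Longrightarrow> is_code (u @ w) \<longleftrightarrow> is_code w"
  by (induction u) auto

lemma contains_iff:
  "contains \<pi> \<tau> \<longleftrightarrow>
     (\<exists>f. strict_mono_on {..<length \<tau>} f \<and> (\<forall>j<length \<tau>. f j < length \<pi>) \<and>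
        (\<forall>i<length \<tau>. \<forall>j<length \<tau>. \<pi> ! f i < \<pi> ! f j \<longleftrightarrow> \<tau> ! i < \<tau> ! j))"
  by (simp add: contains_def order_isomorphic_def)

definition padded_sum :: "nat list \<Rightarrow> nat \<Rightarrow> nat list \<Rightarrow> nat list" where
  "padded_sum \<sigma> m \<rho> = direct_sum \<sigma> (direct_sum [1..<Suc m] \<rho>)"

lemma length_padded_sum: "length (padded_sum \<sigma> m \<rho>) = length \<sigma> + m + length \<rho>"
  by (simp add: padded_sum_def direct_sum_def)

lemma nth_padded_sum:
  assumes "i < length \<sigma> + m + length \<rho>"
  shows "padded_sum \<sigma> m \<rho> ! i =
    (if i < length \<sigma> then \<sigma> ! i else if i < length \<sigma> + m then Suc i
     else \<rho> ! (i - length \<sigma> - m) + m + length \<sigma>)"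
  using assms by (auto simp: padded_sum_def direct_sum_def nth_append simp del: upt_Suc)

text \<open>
  The increasing map onto the positions different from \<open>j\<close>. It is \<^term>\<open>lift j\<close> transported from
  values, which start at 1, to positions, which start at 0.
\<close>

definition skip :: "nat \<Rightarrow> nat \<Rightarrow> nat" where
  "skip j i = (if i < j then i else Suc i)"

lemma skip_less: "skip j x < skip j y \<longleftrightarrow> x < y"
  by (auto simp: skip_def)

text \<open>
  Every \<open>j\<close> between \<open>length \<sigma>\<close> and \<open>length \<sigma> + m\<close> is the position of a fixed point of the longer
  sum, with value \<open>Suc j\<close>. Deleting it leaves the shorter sum, with the remaining positions and
  values relabelled by \<^term>\<open>skip j\<close> and \<^term>\<open>lift j\<close>.
\<close>

lemma padded_sum_skip:
  assumes "\<forall>x\<in>set \<sigma>. x \<le> length \<sigma>" "\<forall>x\<in>set \<rho>. 0 < x"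
    and "length \<sigma> \<le> j" "j \<le> length \<sigma> + m" "i < length \<sigma> + m + length \<rho>"
  shows "padded_sum \<sigma> (Suc m) \<rho> ! skip j i = lift j (padded_sum \<sigma> m \<rho> ! i)"
proof -
  consider "i < length \<sigma>" | "length \<sigma> \<le> i" "i < length \<sigma> + m" | "length \<sigma> + m \<le> i"
    by linarith
  then show ?thesis
  proof cases
    case 1
    then have "\<sigma> ! i \<le> j"
      using assms(1,3) nth_mem le_trans by blast
    with 1 assms show ?thesis
      by (simp add: nth_padded_sum skip_def lift_def)
  next
    case 2
    with assms show ?thesis
      by (simp add: nth_padded_sum skip_def lift_def)
  next
    case 3
    then have "0 < \<rho> ! (i - (length \<sigma> + m))"
      using assms(2,5) by (simp add: nth_mem)
    with assms(4) have "j < \<rho> ! (i - (length \<sigma> + m)) + m + length \<sigma>"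
      by linarith
    with 3 assms show ?thesis
      by (simp add: nth_padded_sum skip_def lift_def)
  qed
qed

text \<open>
  The longer sum has \<open>m + 1 > length \<tau>\<close> padding points, so any occurrence of \<open>\<tau>\<close> misses one of
  them. Deleting that point gives an occurrence in the shorter sum. The converse holds because the
  shorter sum is itself a pattern of the longer one.
\<close>

lemma contains_padded_sum_Suc:
  assumes \<sigma>: "\<forall>x\<in>set \<sigma>. x \<le> length \<sigma>" and \<rho>: "\<forall>x\<in>set \<rho>. 0 < x" and m: "length \<tau> \<le> m"
  shows "contains (padded_sum \<sigma> (Suc m) \<rho>) \<tau> \<longleftrightarrow> contains (padded_sum \<sigma> m \<rho>) \<tau>"
    (is "contains ?\<pi>' \<tau> \<longleftrightarrow> contains ?\<pi> \<tau>")
proof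
  assume "contains ?\<pi> \<tau>"
  then obtain f where f: "strict_mono_on {..<length \<tau>} f" "\<forall>j<length \<tau>. f j < length ?\<pi>"
    "\<forall>i<length \<tau>. \<forall>j<length \<tau>. ?\<pi> ! f i < ?\<pi> ! f j \<longleftrightarrow> \<tau> ! i < \<tau> ! j"
    unfolding contains_iff by blast
  let ?g = "skip (length \<sigma>) \<circ> f"
  have "strict_mono_on {..<length \<tau>} ?g"
    using f(1) by (simp add: strict_mono_on_def skip_less)
  moreover have "\<forall>j<length \<tau>. ?g j < length ?\<pi>'"
    using f(2) by (auto simp: skip_def length_padded_sum less_SucI)
  moreover have "?\<pi>' ! ?g i = lift (length \<sigma>) (?\<pi> ! f i)" if "i < length \<tau>" for i
    using f(2) that padded_sum_skip[OF \<sigma> \<rho>, of "length \<sigma>" m "f i"]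
    by (simp add: length_padded_sum)
  then have "\<forall>i<length \<tau>. \<forall>j<length \<tau>. ?\<pi>' ! ?g i < ?\<pi>' ! ?g j \<longleftrightarrow> \<tau> ! i < \<tau> ! j"
    using f(3) by (simp add: strict_mono_less[OF strict_mono_lift])
  ultimately show "contains ?\<pi>' \<tau>"
    unfolding contains_iff by blast
next
  assume "contains ?\<pi>' \<tau>"
  then obtain f where f: "strict_mono_on {..<length \<tau>} f" "\<forall>j<length \<tau>. f j < length ?\<pi>'"
    "\<forall>i<length \<tau>. \<forall>j<length \<tau>. ?\<pi>' ! f i < ?\<pi>' ! f j \<longleftrightarrow> \<tau> ! i < \<tau> ! j"
    unfolding contains_iff by blast
  have "card (f ` {..<length \<tau>}) \<le> length \<tau>"
    using card_image_le[of "{..<length \<tau>}" f] by simp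
  then have "\<not> {length \<sigma>..length \<sigma> + m} \<subseteq> f ` {..<length \<tau>}"
    using card_mono[of "f ` {..<length \<tau>}" "{length \<sigma>..length \<sigma> + m}"] m by auto
  then obtain j where j: "length \<sigma> \<le> j" "j \<le> length \<sigma> + m" "j \<notin> f ` {..<length \<tau>}"
    by (meson atLeastAtMost_iff subsetI)
  define g where "g i = (if f i < j then f i else f i - 1)" for i
  have g: "skip j (g i) = f i" if "i < length \<tau>" for i
  proof -
    have "f i \<noteq> j" using j(3) that by auto
    then show ?thesis by (auto simp: g_def skip_def)
  qed
  have "strict_mono_on {..<length \<tau>} g"
    using f(1) g skip_less unfolding strict_mono_on_def by (metis lessThan_iff)
  moreover have g_less: "g i < length ?\<pi>" if "i < length \<tau>" for i
  proof -
    have "skip j (g i) < length \<sigma> + Suc m + length \<rho>"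
      using f(2) g that by (simp add: length_padded_sum)
    then show ?thesis
      using j(2) by (auto simp: skip_def length_padded_sum split: if_splits)
  qed
  moreover have "?\<pi>' ! f i = lift j (?\<pi> ! g i)" if "i < length \<tau>" for i
    using padded_sum_skip[OF \<sigma> \<rho> j(1,2), of "g i"] g[OF that] g_less[OF that]
    by (simp add: length_padded_sum)
  then have "\<forall>i<length \<tau>. \<forall>j<length \<tau>. ?\<pi> ! g i < ?\<pi> ! g j \<longleftrightarrow> \<tau> ! i < \<tau> ! j"
    using f(3) by (simp add: strict_mono_less[OF strict_mono_lift])
  ultimately show "contains ?\<pi> \<tau>"
    unfolding contains_iff by blast
qed

text \<open>
  Of the \<open>k + length \<tau>\<close> zeros, the first \<open>k\<close> complete the prefix \<open>u\<close> to a code; the others are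
  the padding in the middle of a direct sum.
\<close>

lemma run_stable_avoiding_codes:
  "run_stable (k + length \<tau>) k (\<lambda>c. is_code c \<and> avoids (decode c) \<tau>)"
  unfolding run_stable_def
proof (intro allI impI)
  fix u v :: "nat list"
  assume k: "sum_list u + sum_list v = k"
  define w where "w = u @ replicate k 0"
  have zeros: "is_code (replicate m 0 @ x) \<longleftrightarrow> is_code x" for m x
    by (rule is_code_append) (simp add: sum_list_replicate)
  have "is_code (replicate k 0 @ [])"
    unfolding zeros by simp
  then have w: "is_code w"
    unfolding w_def using k by (subst is_code_append) simp_all
  have split: "u @ replicate (k + m) 0 @ v = w @ replicate m 0 @ v" for m
    by (simp add: w_def replicate_add)
  have code: "is_code (u @ replicate (k + m) 0 @ v) \<longleftrightarrow> is_code v" for m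
    using k by (simp add: is_code_append zeros)
  have "is_code (replicate m 0)" for m
    using zeros[of m "[]"] by simp
  then have decode: "decode (u @ replicate (k + m) 0 @ v) = padded_sum (decode w) m (decode v)" for m
    unfolding split padded_sum_def by (simp only: decode_append w decode_zeros)
  have "\<forall>x\<in>set (decode w). x \<le> length (decode w)"
    using decode_permutation[OF w] by (auto dest: permutations_of_setD)
  moreover have "\<forall>x\<in>set (decode v). 0 < x"
    using decode_pos by blast
  ultimately have "contains (decode (u @ replicate (k + Suc (length \<tau>)) 0 @ v)) \<tau> \<longleftrightarrow>
      contains (decode (u @ replicate (k + length \<tau>) 0 @ v)) \<tau>"
    unfolding decode by (intro contains_padded_sum_Suc) simp_all
  then show "(is_code (u @ replicate (Suc (k + length \<tau>)) 0 @ v) \<and>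
        avoids (decode (u @ replicate (Suc (k + length \<tau>)) 0 @ v)) \<tau>) =
      (is_code (u @ replicate (k + length \<tau>) 0 @ v) \<and>
        avoids (decode (u @ replicate (k + length \<tau>) 0 @ v)) \<tau>)"
    unfolding avoids_def add_Suc_right[symmetric] code by blast
qed

section \<open>Fibonacci permutations\<close>

text \<open>
  This characterises Fibonacci permutations among all permutations, and unlike a
  decomposition into summands it visibly passes to patterns: between the positions of a
  non-adjacent inversion of the pattern there is a third position, which survives in the host.
\<close>

definition adjacent_inversions :: "nat list \<Rightarrow> bool" where
  "adjacent_inversions \<pi> \<longleftrightarrow> (\<forall>(i, j)\<in>inversions \<pi>. j = Suc i)"

lemma contains_adjacent_inversions:
  assumes "contains \<pi> \<tau>" "adjacent_inversions \<pi>"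
  shows "adjacent_inversions \<tau>"
  unfolding adjacent_inversions_def
proof clarify
  fix i j assume "(i, j) \<in> inversions \<tau>"
  then have ij: "i < j" "j < length \<tau>" "\<tau> ! j < \<tau> ! i"
    by (auto simp: inversions_def)
  obtain f where f: "strict_mono_on {..<length \<tau>} f" "\<forall>j<length \<tau>. f j < length \<pi>"
    "\<forall>i<length \<tau>. \<forall>j<length \<tau>. \<pi> ! f i < \<pi> ! f j \<longleftrightarrow> \<tau> ! i < \<tau> ! j"
    using assms(1) unfolding contains_iff by blast
  have mono: "f x < f y" if "x < y" "y < length \<tau>" for x y
    using strict_mono_onD[OF f(1)] that by simp
  have "(f i, f j) \<in> inversions \<pi>"
    using ij f mono by (simp add: inversions_def)
  then have "f j = Suc (f i)"
    using assms(2) by (auto simp: adjacent_inversions_def)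
  show "j = Suc i"
  proof (rule ccontr)
    assume "j \<noteq> Suc i"
    then have "f i < f (Suc i)" "f (Suc i) < f j"
      using mono[of i "Suc i"] mono[of "Suc i" j] ij by auto
    with \<open>f j = Suc (f i)\<close> show False by simp
  qed
qed

lemma adjacent_inversions_decode_Cons:
  "adjacent_inversions (decode (a # c)) \<longleftrightarrow>
     (\<forall>j<length c. decode c ! j \<le> a \<longrightarrow> j = 0) \<and> adjacent_inversions (decode c)"
  unfolding adjacent_inversions_def inversions_decode_Cons ball_Un ball_simps by auto

lemma adjacent_inversions_fib_code:
  "fib_code c \<Longrightarrow> adjacent_inversions (decode c)"
proof (induction rule: fib_code.induct)
  case Nil
  show ?case by (simp add: adjacent_inversions_def inversions_def)
next
  case (zero c)
  have "\<not> decode c ! j \<le> 0" if "j < length c" for j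
    using decode_pos[of "decode c ! j" c] that by simp
  then show ?case
    unfolding adjacent_inversions_decode_Cons using zero.IH by blast
next
  case (one_zero c)
  have pos: "\<not> decode c ! j \<le> 0" if "j < length c" for j
    using decode_pos[of "decode c ! j" c] that by simp
  have "j = 0" if "j < length (0 # c)" "decode (0 # c) ! j \<le> 1" for j
  proof (cases j)
    case (Suc i)
    with that pos[of i] show ?thesis by (simp add: lift_def)
  qed
  then show ?case
    unfolding adjacent_inversions_decode_Cons using pos one_zero.IH by blast
qed

text \<open>
  A head letter \<open>a\<close> creates \<open>a\<close> inversions from the first position. All of them have to end in
  the second position, so \<open>a \<le> 1\<close>; and if \<open>a = 1\<close>, the second entry is the smallest of the tail,
  that is, the second letter is \<open>0\<close>.
\<close>

lemma fib_code_if_adjacent_inversions: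
  "is_code c \<Longrightarrow> adjacent_inversions (decode c) \<Longrightarrow> fib_code c"
proof (induction c)
  case Nil
  show ?case by (rule fib_code.Nil)
next
  case (Cons a c)
  let ?J = "{j. j < length c \<and> decode c ! j \<le> a}"
  have c: "is_code c" "a \<le> length c" "?J \<subseteq> {0}" "adjacent_inversions (decode c)"
    using Cons.prems by (auto simp: adjacent_inversions_decode_Cons simp del: decode.simps)
  have fib: "fib_code c"
    using Cons.IH c by blast
  have card_J: "card ?J = a"
    using c by (intro card_small_positions)
  show ?case
  proof (cases "a = 0")
    case True
    with fib show ?thesis by (simp add: fib_code.zero)
  next
    case False
    with card_J c(3) have "?J = {0}"
      by (metis card.empty subset_singletonD)
    then have "a = 1" "c \<noteq> []" "decode c ! 0 \<le> a"
      using card_J by auto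
    moreover from this obtain b d where "c = b # d"
      by (cases c) auto
    ultimately have "c = 0 # d" by simp
    with fib \<open>a = 1\<close> show ?thesis
      using fib_code.one_zero fib_code_zeroD by blast
  qed
qed

lemma is_code_fib_code: "fib_code c \<Longrightarrow> is_code c"
  by (induction rule: fib_code.induct) simp_all

lemma fibonacci_permutation_Cons:
  assumes "\<alpha> \<in> {[1], [2, 1]}" "fibonacci_permutation \<pi>"
  shows "fibonacci_permutation (direct_sum \<alpha> \<pi>)"
proof -
  obtain \<alpha>s where "set \<alpha>s \<subseteq> {[1], [2, 1]}" "\<pi> = foldr direct_sum \<alpha>s []"
    using assms(2) unfolding fibonacci_permutation_def by blast
  then have "set (\<alpha> # \<alpha>s) \<subseteq> {[1], [2, 1]} \<and> direct_sum \<alpha> \<pi> = foldr direct_sum (\<alpha> # \<alpha>s) []"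
    using assms(1) by simp
  then show ?thesis
    unfolding fibonacci_permutation_def by blast
qed

lemma fibonacci_permutation_fib_code:
  "fib_code c \<Longrightarrow> fibonacci_permutation (decode c)"
proof (induction rule: fib_code.induct)
  case Nil
  show ?case
    unfolding fibonacci_permutation_def by (rule exI[of _ "[]"]) simp
next
  case (zero c)
  have "decode ([0] @ c) = direct_sum [1] (decode c)"
    by (subst decode_append) simp_all
  with zero.IH show ?case
    using fibonacci_permutation_Cons[of "[1]"] by simp
next
  case (one_zero c)
  have "decode ([1, 0] @ c) = direct_sum [2, 1] (decode c)"
    by (subst decode_append) (simp_all add: lift_def numeral_2_eq_2)
  with one_zero.IH show ?case
    using fibonacci_permutation_Cons[of "[2, 1]"] by simp
qed

lemma fib_code_avoids:
  assumes "is_permutation \<tau>" "\<not> fibonacci_permutation \<tau>" "fib_code c"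
  shows "avoids (decode c) \<tau>"
  unfolding avoids_def
proof
  assume "contains (decode c) \<tau>"
  then have \<tau>: "adjacent_inversions \<tau>"
    using contains_adjacent_inversions adjacent_inversions_fib_code[OF assms(3)] by blast
  obtain d where "is_code d" "decode d = \<tau>"
    using assms(1) decode_surj unfolding is_permutation_def by blast
  with \<tau> have "fibonacci_permutation \<tau>"
    using fib_code_if_adjacent_inversions fibonacci_permutation_fib_code by blast
  with assms(2) show False by blast
qed

section \<open>The polynomial and its leading term\<close>

lemma poly_bigo:
  fixes p :: "real poly"
  assumes "degree p \<le> d"
  shows "(\<lambda>n. poly p (real n)) \<in> O(\<lambda>n. real n ^ d)"
proof -
  have "(\<lambda>n. coeff p i * real n ^ i) \<in> O(\<lambda>n. real n ^ d)" if "i \<le> degree p" for i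
  proof (rule bigoI[of _ "\<bar>coeff p i\<bar>"])
    show "\<forall>\<^sub>F n in sequentially. norm (coeff p i * real n ^ i) \<le> \<bar>coeff p i\<bar> * norm (real n ^ d)"
      using eventually_ge_at_top[of 1]
    proof eventually_elim
      case (elim n)
      then have "real n ^ i \<le> real n ^ d"
        using that assms by (intro power_increasing) auto
      then show ?case
        by (simp add: abs_mult mult_left_mono)
    qed
  qed
  then show ?thesis
    unfolding poly_altdef by (intro big_sum_in_bigo) auto
qed

theorem proposition23:
  fixes \<tau> :: "nat list" and k :: nat
  assumes "is_permutation \<tau>"
    and "\<not> fibonacci_permutation \<tau>"
  shows "\<exists>(P :: real poly) (n0 :: nat).
    degree P = k \<and>
    (\<forall>n\<ge>n0. real (num_avoiders \<tau> n k) = poly P (real n)) \<and>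
    (\<lambda>n::nat. poly P (real n) - real n ^ k / fact k) \<in> O(\<lambda>n. real n powi (int k - 1))"
proof -
  \<comment> \<open>The empty permutation is Fibonacci, so \<open>\<tau>\<close> is nonempty and the zero runs have positive
      length even for \<open>k = 0\<close>.\<close>
  have "fibonacci_permutation []"
    unfolding fibonacci_permutation_def by (rule exI[of _ "[]"]) simp
  then have "\<tau> \<noteq> []"
    using assms(2) by blast
  then have "k + length \<tau> > 0" by simp
  let ?Q = "\<lambda>c. is_code c \<and> avoids (decode c) \<tau>"
  from word_count_eventually_poly[OF \<open>k + length \<tau> > 0\<close> run_stable_avoiding_codes]
  obtain a where a: "eventually_poly k a (\<lambda>n. real (word_count ?Q n k))"
    "(\<forall>c. fib_code (0 # c) \<and> sum_list c = k \<longrightarrow> ?Q (0 # c)) \<longrightarrow> a = 1 / fact k"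
    by blast
  have "a = 1 / fact k"
    using a(2) is_code_fib_code fib_code_avoids[OF assms] by blast
  with a(1) obtain P n0 where P: "degree P \<le> k" "coeff P k = 1 / fact k"
    "\<forall>n\<ge>n0. real (num_avoiders \<tau> n k) = poly P (real n)"
    unfolding eventually_poly_def eventually_sequentially num_avoiders_word_count by blast
  have "coeff P k \<noteq> 0"
    using P(2) by simp
  with P(1) have "degree P = k"
    by (intro antisym le_degree)
  define R where "R = P - monom (1 / fact k) k"
  have R: "poly P (real n) - real n ^ k / fact k = poly R (real n)" for n
    by (simp add: R_def poly_monom)
  have R_coeff: "coeff R k = 0" and R_deg: "degree R \<le> k"
    using P(1,2) degree_monom_le[of "1 / fact k :: real" k] by (auto simp: R_def intro: degree_diff_le)
  have "(\<lambda>n. poly R (real n)) \<in> O(\<lambda>n. real n powi (int k - 1))"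
  proof (cases k)
    case 0
    then have "R = 0"
      using R_coeff R_deg by (metis le_zero_eq leading_coeff_0_iff)
    then show ?thesis by simp
  next
    case (Suc d)
    then have "degree R \<le> d"
      using R_coeff R_deg by (metis degree_0 le_SucE leading_coeff_0_iff le0)
    then show ?thesis
      using poly_bigo[of R d] by (simp add: Suc)
  qed
  then have "(\<lambda>n. poly P (real n) - real n ^ k / fact k) \<in> O(\<lambda>n. real n powi (int k - 1))"
    by (simp only: R)
  with \<open>degree P = k\<close> P(3) show ?thesis by blast
qed

end
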